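(* Let $\Phi$ be a symmetric gauge function on $\mathbb{R}^n$. If $\mathbf{x},\mathbf{y}\in\mathbb{R}^n_+$ and $\mathbf{x}\prec_{\mathrm{w}}\mathbf{y}$, then $\Phi(\mathbf{x})\leq\Phi(\mathbf{y})$.
   Context: $\mathbb{R}_+=[0,\infty)$. For $\mathbf{x}=[x_i]\in\mathbb{R}^n$, let $|\mathbf{x}|:=(|x_1|,\ldots,|x_n|)$, and for a permutation $\sigma$ of $\{1,\ldots,n\}$ let $\mathbf{x}_\sigma:=(x_{\sigma(1)},\ldots,x_{\sigma(n)})$. Write $\mathbf{x}\leq_{\mathrm{e}}\mathbf{y}$ if $x_j\leq y_j$ for all $j$. A symmetric gauge function on $\mathbb{R}^n$ is a norm $\Phi$ on $\mathbb{R}^n$ that is absolute ($\Phi(|\mathbf{x}|)=\Phi(\mathbf{x})$ for all $\mathbf{x}$), monotone ($|\mathbf{x}|\leq_{\mathrm{e}}|\mathbf{y}|$ implies $\Phi(\mathbf{x})\leq\Phi(\mathbf{y})$), and symmetric ($\Phi(\mathbf{x}_\sigma)=\Phi(\mathbf{x})$ for all $\mathbf{x}$ and all permutations $\sigma$). Let $x_{[1]}\geq\cdots\geq x_{[n]}$ denote the entries of $\mathbf{x}$ in decreasing order; $\mathbf{x}\prec_{\mathrm{w}}\mathbf{y}$ (weak majorization) means $\sum_{i=1}^k x_{[i]}\leq\sum_{i=1}^k y_{[i]}$ for each $1\leq k\leq n$. *)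

theory Defs
  imports "HOL-Analysis.Analysis"
begin

definition is_norm :: "(real ^ 'n \<Rightarrow> real) \<Rightarrow> bool" where
  "is_norm \<Phi> \<longleftrightarrow>
     (\<forall>x. 0 \<le> \<Phi> x) \<and>
     (\<forall>x. \<Phi> x = 0 \<longleftrightarrow> x = 0) \<and>
     (\<forall>c x. \<Phi> (c *\<^sub>R x) = \<bar>c\<bar> * \<Phi> x) \<and>
     (\<forall>x y. \<Phi> (x + y) \<le> \<Phi> x + \<Phi> y)"

text \<open>On \<^typ>\<open>real ^ 'n\<close>, both \<open>\<bar>x\<bar>\<close> and \<open>\<le>\<close> are the componentwise
  library operations.\<close>

definition symmetric_gauge :: "(real ^ 'n \<Rightarrow> real) \<Rightarrow> bool" where
  "symmetric_gauge \<Phi> \<longleftrightarrow>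
     is_norm \<Phi> \<and>
     (\<forall>x. \<Phi> \<bar>x\<bar> = \<Phi> x) \<and>
     (\<forall>x y. \<bar>x\<bar> \<le> \<bar>y\<bar> \<longrightarrow> \<Phi> x \<le> \<Phi> y) \<and>
     (\<forall>x \<sigma>. \<sigma> permutes UNIV \<longrightarrow> \<Phi> (\<chi> i. x $ \<sigma> i) = \<Phi> x)"

definition decreasing_entries :: "real ^ 'n \<Rightarrow> real list" where
  "decreasing_entries x =
     rev (sorted_list_of_multiset (image_mset (($) x) (mset_set UNIV)))"

text \<open>\<open>sorted_entry x i\<close> is the \<open>i\<close>-th largest entry of \<open>x\<close>, counted with multiplicity and
  with \<open>i\<close> starting at 1; it is meaningful only for \<open>1 \<le> i \<le> CARD('n)\<close>.\<close>

definition sorted_entry :: "real ^ 'n \<Rightarrow> nat \<Rightarrow> real" where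
  "sorted_entry x i = decreasing_entries x ! (i - 1)"

definition weakly_majorized :: "real ^ 'n \<Rightarrow> real ^ 'n \<Rightarrow> bool"  (infix "\<prec>\<^sub>w" 50) where
  "x \<prec>\<^sub>w y \<longleftrightarrow>
     (\<forall>k\<in>{1..CARD('n)}. (\<Sum>i=1..k. sorted_entry x i) \<le> (\<Sum>i=1..k. sorted_entry y i))"

end

theory Submission
  imports Defs
begin

text \<open>
  The sublevel set \<open>C = {z. \<Phi> z \<le> \<Phi> y}\<close> is closed and convex and contains every vector obtained
  from \<open>y\<close> by permuting entries and changing signs, since \<open>\<Phi>\<close> is symmetric and absolute. If \<open>x\<close> were outside \<open>C\<close>, a hyperplane with
  normal vector \<open>a\<close> would separate \<open>x\<close> strictly from \<open>C\<close>. This is impossible, because \<open>C\<close> contains a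
  \<open>z\<close> with \<open>a \<bullet> x \<le> a \<bullet> z\<close>: permute \<open>y\<close> so that its entries are ordered in the same way as those of
  \<open>\<bar>a\<bar>\<close>, and give them the signs of the entries of \<open>a\<close>. Then
  \<open>a \<bullet> x \<le> (\<Sum>i. \<bar>a\<^sub>i\<bar> * x\<^sub>i) \<le> (\<Sum>i. w\<^sub>i * u\<^sub>i) = a \<bullet> z\<close>, where \<open>w\<^sub>1 \<ge> w\<^sub>2 \<ge> \<dots>\<close> are the numbers
  \<open>\<bar>a\<^sub>i\<bar>\<close>, and \<open>u\<^sub>1 \<ge> u\<^sub>2 \<ge> \<dots>\<close> the entries of \<open>y\<close>, in decreasing order.
  The middle inequality (\<open>weighted_sum_le_permuted\<close>) is summation by parts: the weights
  \<open>w\<^sub>i\<close> are nonnegative and decreasing, and a sum of any \<open>k\<close> entries of \<open>x\<close> is at most the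
  sum of its \<open>k\<close> largest entries, hence at most that of \<open>y\<close>.
\<close>

text \<open>The indices of \<open>v\<close>, listed as \<open>p 0, p 1, \<dots>\<close> so that the entries decrease along the list. The
  shift by one arises because \<open>sorted_entry\<close> counts from 1.\<close>

lemma sorting_enumeration:
  fixes v :: "real ^ 'n"
  obtains p :: "nat \<Rightarrow> 'n" where "bij_betw p {..<CARD('n)} UNIV"
    and "\<And>i. i < CARD('n) \<Longrightarrow> v $ p i = sorted_entry v (Suc i)"
    and "\<And>i j. i \<le> j \<Longrightarrow> j < CARD('n) \<Longrightarrow> v $ p j \<le> v $ p i"
proof -
  obtain us :: "'n list" where us: "set us = UNIV" "distinct us"
    using finite_distinct_list[OF finite_class.finite_UNIV] by blast
  define ps where "ps = rev (sort_key (($) v) us)"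
  have ps: "set ps = UNIV" "distinct ps"
    using us by (auto simp: ps_def)
  have len: "length ps = CARD('n)"
    using ps distinct_card by metis
  have "mset us = mset_set UNIV"
    using us by (metis mset_set_set)
  then have "sorted_list_of_multiset (image_mset (($) v) (mset_set UNIV))
      = sort (map (($) v) us)"
    by (metis mset_map sorted_list_of_multiset_mset)
  also have "\<dots> = map (($) v) (sort_key (($) v) us)"
    by (rule properties_for_sort) auto
  finally have dec: "decreasing_entries v = map (($) v) ps"
    by (simp add: decreasing_entries_def ps_def rev_map)
  have sorted: "sorted (rev (map (($) v) ps))"
    by (simp add: ps_def rev_map)
  show ?thesis
  proof
    show "bij_betw ((!) ps) {..<CARD('n)} UNIV"
      using bij_betw_nth[OF ps(2)] ps(1) len by metis
    show "v $ (ps ! i) = sorted_entry v (Suc i)" if "i < CARD('n)" for i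
      using that len by (simp add: sorted_entry_def dec)
    show "v $ (ps ! j) \<le> v $ (ps ! i)" if "i \<le> j" "j < CARD('n)" for i j
      using sorted_rev_nth_mono[OF sorted] that len by fastforce
  qed
qed

lemma sum_le_sum_sorted_entry:
  fixes v :: "real ^ 'n"
  shows "(\<Sum>i\<in>A. v $ i) \<le> (\<Sum>i=1..card A. sorted_entry v i)"
proof (cases "A = {}")
  case False
  obtain p :: "nat \<Rightarrow> 'n" where bij: "bij_betw p {..<CARD('n)} UNIV"
    and entry: "\<And>i. i < CARD('n) \<Longrightarrow> v $ p i = sorted_entry v (Suc i)"
    and anti: "\<And>i j. i \<le> j \<Longrightarrow> j < CARD('n) \<Longrightarrow> v $ p j \<le> v $ p i"
    by (rule sorting_enumeration[of v]) (rule that)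
  define k where "k = card A"
  define T where "T = p ` {..<k}"
  define t where "t = v $ p (k - 1)"
  have k: "0 < k" "k \<le> CARD('n)"
    using False by (auto simp: k_def card_gt_0_iff card_mono)
  have inj: "inj_on p {..<k}"
    using bij k(2) by (auto simp: bij_betw_def intro: inj_on_subset)
  have ge: "t \<le> v $ j" if "j \<in> T" for j
    using that anti k unfolding T_def t_def by fastforce
  have le: "v $ j \<le> t" if "j \<notin> T" for j
  proof -
    obtain i where i: "j = p i" "i < CARD('n)"
      using bij by (metis UNIV_I bij_betw_def imageE lessThan_iff)
    with that have "k \<le> i"
      by (force simp: T_def)
    then show ?thesis
      using anti[of "k - 1" i] i by (simp add: t_def)
  qed
  \<comment> \<open>The \<open>k\<close>-th largest entry \<open>t\<close> is a threshold: \<open>v j - t\<close> is nonnegative on \<open>T\<close> and nonpositive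
    off \<open>T\<close>.\<close>
  have "(\<Sum>j\<in>A. v $ j - t) = (\<Sum>j\<in>A \<inter> T. v $ j - t) + (\<Sum>j\<in>A - T. v $ j - t)"
    by (simp add: sum.Int_Diff)
  also have "\<dots> \<le> (\<Sum>j\<in>A \<inter> T. v $ j - t)"
    using sum_nonpos[of "A - T" "\<lambda>j. v $ j - t"] le by simp
  also have "\<dots> \<le> (\<Sum>j\<in>T. v $ j - t)"
    using ge by (intro sum_mono2) auto
  finally have "(\<Sum>j\<in>A. v $ j) \<le> (\<Sum>j\<in>T. v $ j)"
    by (simp add: sum_subtractf T_def card_image[OF inj] flip: k_def)
  also have "\<dots> = (\<Sum>i<k. v $ p i)"
    by (simp add: T_def sum.reindex[OF inj])
  also have "\<dots> = (\<Sum>i<k. sorted_entry v (Suc i))"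
    using entry k(2) by (intro sum.cong) auto
  also have "\<dots> = (\<Sum>i=1..k. sorted_entry v i)"
    by (simp add: sum.atLeast1_atMost_eq)
  finally show ?thesis
    by (simp add: k_def)
qed simp

text \<open>Abel's inequality: nonnegative decreasing weights preserve nonnegativity of partial sums.\<close>

lemma sum_decreasing_weights_nonneg:
  fixes w d :: "nat \<Rightarrow> real"
  assumes "\<And>i. i < n \<Longrightarrow> 0 \<le> w i"
    and "\<And>i j. i \<le> j \<Longrightarrow> j < n \<Longrightarrow> w j \<le> w i"
    and "\<And>k. k \<le> n \<Longrightarrow> 0 \<le> (\<Sum>i<k. d i)"
  shows "0 \<le> (\<Sum>i<n. w i * d i)"
proof (cases n)
  case (Suc m)
  \<comment> \<open>A lower bound for the partial sums that is stable under induction.\<close>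
  have "w k * (\<Sum>i<Suc k. d i) \<le> (\<Sum>i<Suc k. w i * d i)" if "k < n" for k
    using that
  proof (induction k)
    case (Suc k)
    have "w (Suc k) * (\<Sum>i<Suc k. d i) \<le> w k * (\<Sum>i<Suc k. d i)"
      using Suc.prems by (intro mult_right_mono assms) auto
    also have "\<dots> \<le> (\<Sum>i<Suc k. w i * d i)"
      using Suc by simp
    finally show ?case
      by (simp add: distrib_left)
  qed simp
  from this[of m] have "w m * (\<Sum>i<n. d i) \<le> (\<Sum>i<n. w i * d i)"
    by (simp add: Suc)
  moreover have "0 \<le> w m * (\<Sum>i<n. d i)"
    using Suc by (intro mult_nonneg_nonneg assms) auto
  ultimately show ?thesis
    by simp
qed simp

text \<open>Although \<open>x\<close> need not be ordered like \<open>w\<close>, no rearrangement inequality for \<open>x\<close> is required: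
  the partial sums of \<open>x\<close> along the order of \<open>w\<close> are sums of \<open>k\<close> entries, so the \<open>k\<close> largest
  entries already bound them.\<close>

lemma weighted_sum_le_permuted:
  fixes w x y :: "real ^ 'n"
  assumes w: "\<And>i. 0 \<le> w $ i" and "x \<prec>\<^sub>w y"
  obtains \<sigma> where "\<sigma> permutes UNIV"
    and "(\<Sum>i\<in>UNIV. w $ i * x $ i) \<le> (\<Sum>i\<in>UNIV. w $ i * y $ \<sigma> i)"
proof -
  let ?n = "CARD('n)"
  obtain p :: "nat \<Rightarrow> 'n" where p: "bij_betw p {..<?n} UNIV"
    and wp: "\<And>i j. i \<le> j \<Longrightarrow> j < ?n \<Longrightarrow> w $ p j \<le> w $ p i"
    by (rule sorting_enumeration[of w]) (rule that)
  obtain q :: "nat \<Rightarrow> 'n" where q: "bij_betw q {..<?n} UNIV"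
    and yq: "\<And>i. i < ?n \<Longrightarrow> y $ q i = sorted_entry y (Suc i)"
    by (rule sorting_enumeration[of y]) (rule that)
  \<comment> \<open>\<open>\<sigma>\<close> sends the position of the \<open>i\<close>-th largest weight to that of the \<open>i\<close>-th largest entry
    of \<open>y\<close>.\<close>
  define \<sigma> where "\<sigma> = q \<circ> inv_into {..<?n} p"
  have "bij \<sigma>"
    unfolding \<sigma>_def using bij_betw_trans[OF bij_betw_inv_into[OF p] q] .
  then have perm: "\<sigma> permutes UNIV"
    by (intro bij_imp_permutes) auto
  have \<sigma>p: "\<sigma> (p i) = q i" if "i < ?n" for i
    using that p by (simp add: \<sigma>_def bij_betw_def)
  have partial: "(\<Sum>i<k. x $ p i) \<le> (\<Sum>i<k. y $ q i)" if "k \<le> ?n" for k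
  proof (cases "k = 0")
    case False
    have inj: "inj_on p {..<k}"
      using p that by (auto simp: bij_betw_def intro: inj_on_subset)
    have "(\<Sum>i<k. x $ p i) = (\<Sum>j\<in>p ` {..<k}. x $ j)"
      by (simp add: sum.reindex[OF inj])
    also have "\<dots> \<le> (\<Sum>i=1..k. sorted_entry x i)"
      using sum_le_sum_sorted_entry[of x "p ` {..<k}"] by (simp add: card_image[OF inj])
    also have "\<dots> \<le> (\<Sum>i=1..k. sorted_entry y i)"
      using \<open>x \<prec>\<^sub>w y\<close> that False by (simp add: weakly_majorized_def)
    also have "\<dots> = (\<Sum>i<k. sorted_entry y (Suc i))"
      by (simp add: sum.atLeast1_atMost_eq)
    also have "\<dots> = (\<Sum>i<k. y $ q i)"
      using yq that by (intro sum.cong) auto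
    finally show ?thesis .
  qed simp
  have "0 \<le> (\<Sum>i<?n. w $ p i * (y $ q i - x $ p i))"
    by (rule sum_decreasing_weights_nonneg) (use w wp partial in \<open>auto simp: sum_subtractf\<close>)
  then have "(\<Sum>i<?n. w $ p i * x $ p i) \<le> (\<Sum>i<?n. w $ p i * y $ q i)"
    by (simp add: right_diff_distrib sum_subtractf)
  also have "\<dots> = (\<Sum>i<?n. w $ p i * y $ \<sigma> (p i))"
    using \<sigma>p by (intro sum.cong) auto
  finally have "(\<Sum>i\<in>UNIV. w $ i * x $ i) \<le> (\<Sum>i\<in>UNIV. w $ i * y $ \<sigma> i)"
    by (simp add: sum.reindex_bij_betw[OF p, of "\<lambda>j. w $ j * x $ j"]
        sum.reindex_bij_betw[OF p, of "\<lambda>j. w $ j * y $ \<sigma> j"])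
  with perm show ?thesis
    by (rule that)
qed

lemma convex_on_is_norm:
  assumes "is_norm \<Phi>"
  shows "convex_on UNIV \<Phi>"
proof (rule convex_onI)
  have scale: "\<Phi> (c *\<^sub>R u) = \<bar>c\<bar> * \<Phi> u" and triangle: "\<Phi> (u + v) \<le> \<Phi> u + \<Phi> v" for c u v
    using assms by (simp_all add: is_norm_def)
  fix t :: real and u v assume "0 < t" "t < 1"
  then show "\<Phi> ((1 - t) *\<^sub>R u + t *\<^sub>R v) \<le> (1 - t) * \<Phi> u + t * \<Phi> v"
    using triangle[of "(1 - t) *\<^sub>R u" "t *\<^sub>R v"] by (simp add: scale)
qed simp

theorem theorem8p1:
  fixes \<Phi> :: "real ^ 'n \<Rightarrow> real" and x y :: "real ^ 'n"
  assumes "symmetric_gauge \<Phi>"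
    and "\<forall>i. 0 \<le> x $ i" and "\<forall>i. 0 \<le> y $ i"
    and "x \<prec>\<^sub>w y"
  shows "\<Phi> x \<le> \<Phi> y"
proof (rule ccontr)
  assume "\<not> \<Phi> x \<le> \<Phi> y"
  define C where "C = {z. \<Phi> z \<le> \<Phi> y}"
  have absolute: "\<Phi> \<bar>z\<bar> = \<Phi> z" for z
    using assms(1) by (simp add: symmetric_gauge_def)
  have conv: "convex_on UNIV \<Phi>"
    using assms(1) by (simp add: symmetric_gauge_def convex_on_is_norm)
  have "\<forall>z\<in>convex hull C. \<Phi> z \<le> \<Phi> y"
    by (intro convex_on_convex_hull_bound convex_on_subset[OF conv])
      (auto simp: C_def)
  then have "convex hull C = C"
    using hull_subset[of C convex] by (auto simp: C_def)
  then have "convex C"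
    by (simp add: convex_hull_eq)
  moreover have "closed C"
    unfolding C_def
    using convex_on_continuous[OF open_UNIV conv] by (intro closed_Collect_le) auto
  moreover have "x \<notin> C"
    using \<open>\<not> \<Phi> x \<le> \<Phi> y\<close> by (simp add: C_def)
  ultimately obtain a' b where ab: "a' \<bullet> x < b" "\<forall>z\<in>C. b < a' \<bullet> z"
    using separating_hyperplane_closed_point[of C x] by auto
  \<comment> \<open>With the opposite normal vector, \<open>x\<close> lies on the upper side.\<close>
  define a where "a = - a'"
  have a: "a \<bullet> z < a \<bullet> x" if "z \<in> C" for z
    using ab that by (force simp: a_def)
  obtain \<sigma> where \<sigma>: "\<sigma> permutes UNIV"
    and le: "(\<Sum>i\<in>UNIV. \<bar>a $ i\<bar> * x $ i) \<le> (\<Sum>i\<in>UNIV. \<bar>a $ i\<bar> * y $ \<sigma> i)"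
    using weighted_sum_le_permuted[of "\<chi> i. \<bar>a $ i\<bar>" x y] assms(4) by auto
  define z :: "real ^ 'n" where "z = (\<chi> i. if a $ i < 0 then - y $ \<sigma> i else y $ \<sigma> i)"
  have "\<bar>z\<bar> = (\<chi> i. y $ \<sigma> i)"
    using assms(3) by (simp add: vec_eq_iff abs_vec_def z_def)
  then have "\<Phi> z = \<Phi> (\<chi> i. y $ \<sigma> i)"
    using absolute[of z] by simp
  also have "\<dots> = \<Phi> y"
    using assms(1) \<sigma> by (simp add: symmetric_gauge_def)
  finally have "z \<in> C"
    by (simp add: C_def)
  have "a \<bullet> x \<le> (\<Sum>i\<in>UNIV. \<bar>a $ i\<bar> * x $ i)"
    using assms(2) by (auto simp: inner_vec_def intro!: sum_mono mult_right_mono)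
  also have "\<dots> \<le> (\<Sum>i\<in>UNIV. \<bar>a $ i\<bar> * y $ \<sigma> i)"
    by (rule le)
  also have "\<dots> = a \<bullet> z"
    by (auto simp: inner_vec_def z_def intro!: sum.cong)
  finally show False
    using a[OF \<open>z \<in> C\<close>] by simp
qed

end
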